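(* (a) The derivation $\partial$ of $F_n$ preserves $J_n$ and so induces a derivation, again denoted $\partial$, of $Q_n$ satisfying $\partial(z_{A,i})=1$ for all $A\subseteq\{1,\dots,n\}$ and $i\notin A$. (b) The antiautomorphism $\theta$ of $F_n$ preserves $J_n$ and so induces an antiautomorphism, again denoted $\theta$, of $Q_n$ satisfying $\theta(z_{A,i})=z_{\{1,\dots,n\}\setminus (A\cup\{i\}),\,i}$ for all $A\subseteq\{1,\dots,n\}$ and $i\notin A$.
   Context: Let $k$ be a field and $n\ge1$. $F_n$ is the free associative unital $k$-algebra on generators $z_{A,i}$, for $A\subseteq\{1,\dots,n\}$ and $i\in\{1,\dots,n\}\setminus A$. $J_n$ is the two-sided ideal of $F_n$ generated by the elements $$z_{A\cup\{i\},j}+z_{A,i}-z_{A\cup\{j\},i}-z_{A,j},\qquad z_{A\cup\{i\},j}\,z_{A,i}-z_{A\cup\{j\},i}\,z_{A,j}$$ for all $A$ and all distinct $i,j\notin A$. $Q_n=F_n/J_n$, and the coset of $z_{A,i}$ is again denoted $z_{A,i}$. A derivation is a $k$-linear map $\partial$ with $\partial(ab)=(\partial a)b+a\,\partial b$. On $F_n$, $\partial$ is the derivation with $\partial(z_{A,i})=1$ for all generators, and $\theta$ is the $k$-linear antiautomorphism with $\theta(z_{A,i})=z_{\{1,\dots,n\}\setminus(A\cup\{i\}),\,i}$ for all generators. *)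

theory Defs
  imports "HOL-Library.Poly_Mapping" "HOL-Library.FuncSet"
    "HOL-Algebra.QuotRing" "HOL-Algebra.Module"
begin

section \<open>The free associative unital algebra on a set\<close>

text \<open>
  Words under concatenation form the free monoid.  They are wrapped in a type of their own so that
  the type class of additive monoids (not necessarily commutative) can be instantiated: the product
  on finitely supported functions provided by \<^theory>\<open>HOL-Library.Poly_Mapping\<close> is convolution with
  respect to the addition on the index type, and therefore becomes the product of the monoid algebra.
\<close>

datatype 'g word = Word (letters: "'g list")

instantiation word :: (type) monoid_add
begin

definition zero_word :: "'a word" where "0 = Word []"

definition plus_word :: "'a word \<Rightarrow> 'a word \<Rightarrow> 'a word"
  where "u + v = Word (letters u @ letters v)"

instance by standard (simp_all add: zero_word_def plus_word_def)

end

type_synonym ('g, 'k) ncpoly = "'g word \<Rightarrow>\<^sub>0 'k"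

definition var :: "'g \<Rightarrow> ('g, 'k::field) ncpoly"
  where "var g = Poly_Mapping.single (Word [g]) 1"

definition free_algebra :: "'g set \<Rightarrow> ('k::field, ('g, 'k) ncpoly) module"
  where "free_algebra G =
    \<lparr>carrier = {p. \<forall>w\<in>Poly_Mapping.keys p. set (letters w) \<subseteq> G},
     mult = (*), one = 1, zero = 0, add = (+),
     smult = (\<lambda>c. Poly_Mapping.map ((*) c))\<rparr>"


section \<open>Quotient algebras, derivations, antiautomorphisms\<close>

text \<open>
  The scalars are all elements of the field type \<open>'k\<close>.  The quotient ring of
  \<^theory>\<open>HOL-Algebra.QuotRing\<close> forgets scalar multiplication; it is put back here, in the same
  style in which the library defines the product of two cosets.
\<close>

definition quotient_algebra :: "('k::field, 'a) module \<Rightarrow> 'a set \<Rightarrow> ('k, 'a set) module"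
  where "quotient_algebra R I =
    ring.extend (R Quot I) (module.fields (\<lambda>c X. \<Union>x\<in>X. I +>\<^bsub>R\<^esub> (c \<odot>\<^bsub>R\<^esub> x)))"

definition linear_endo :: "('k::field, 'a) module \<Rightarrow> ('a \<Rightarrow> 'a) \<Rightarrow> bool"
  where "linear_endo R f \<longleftrightarrow>
    f \<in> carrier R \<rightarrow> carrier R \<and>
    (\<forall>a\<in>carrier R. \<forall>b\<in>carrier R. f (a \<oplus>\<^bsub>R\<^esub> b) = f a \<oplus>\<^bsub>R\<^esub> f b) \<and>
    (\<forall>c. \<forall>a\<in>carrier R. f (c \<odot>\<^bsub>R\<^esub> a) = c \<odot>\<^bsub>R\<^esub> f a)"

definition derivation :: "('k::field, 'a) module \<Rightarrow> ('a \<Rightarrow> 'a) \<Rightarrow> bool"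
  where "derivation R d \<longleftrightarrow>
    linear_endo R d \<and>
    (\<forall>a\<in>carrier R. \<forall>b\<in>carrier R. d (a \<otimes>\<^bsub>R\<^esub> b) = d a \<otimes>\<^bsub>R\<^esub> b \<oplus>\<^bsub>R\<^esub> a \<otimes>\<^bsub>R\<^esub> d b)"

definition antiautomorphism :: "('k::field, 'a) module \<Rightarrow> ('a \<Rightarrow> 'a) \<Rightarrow> bool"
  where "antiautomorphism R t \<longleftrightarrow>
    linear_endo R t \<and> bij_betw t (carrier R) (carrier R) \<and> t \<one>\<^bsub>R\<^esub> = \<one>\<^bsub>R\<^esub> \<and>
    (\<forall>a\<in>carrier R. \<forall>b\<in>carrier R. t (a \<otimes>\<^bsub>R\<^esub> b) = t b \<otimes>\<^bsub>R\<^esub> t a)"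


section \<open>The algebras \<open>F\<^sub>n\<close> and \<open>Q\<^sub>n\<close>\<close>

type_synonym 'k zpoly = "(nat set \<times> nat, 'k) ncpoly"

definition z_index :: "nat \<Rightarrow> (nat set \<times> nat) set"
  where "z_index n = {(A, i). A \<subseteq> {1..n} \<and> i \<in> {1..n} - A}"

definition z :: "nat set \<Rightarrow> nat \<Rightarrow> 'k::field zpoly"
  where "z A i = var (A, i)"

definition F :: "nat \<Rightarrow> ('k::field, 'k zpoly) module"
  where "F n = free_algebra (z_index n)"

definition J_gens :: "nat \<Rightarrow> 'k::field zpoly set"
  where "J_gens n =
    {z (A \<union> {i}) j + z A i - z (A \<union> {j}) i - z A j | A i j.
       A \<subseteq> {1..n} \<and> i \<in> {1..n} - A \<and> j \<in> {1..n} - A \<and> i \<noteq> j} \<union>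
    {z (A \<union> {i}) j * z A i - z (A \<union> {j}) i * z A j | A i j.
       A \<subseteq> {1..n} \<and> i \<in> {1..n} - A \<and> j \<in> {1..n} - A \<and> i \<noteq> j}"

definition J :: "nat \<Rightarrow> 'k::field zpoly set"
  where "J n = Idl\<^bsub>F n\<^esub> (J_gens n)"

definition Q :: "nat \<Rightarrow> ('k::field, 'k zpoly set) module"
  where "Q n = quotient_algebra (F n) (J n)"

definition zQ :: "nat \<Rightarrow> nat set \<Rightarrow> nat \<Rightarrow> 'k::field zpoly set"
  where "zQ n A i = J n +>\<^bsub>F n\<^esub> z A i"

text \<open>
  The derivation and the antiautomorphism of \<open>F\<^sub>n\<close> are given by definite descriptions; restricting to
  extensional functions fixes the irrelevant values outside the carrier.  That the descriptions are
  proper is shown in \<open>del_ex1\<close> and \<open>theta_ex1\<close> below.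
\<close>

definition del :: "nat \<Rightarrow> 'k::field zpoly \<Rightarrow> 'k zpoly"
  where "del n = (THE d. d \<in> extensional (carrier (F n)) \<and> derivation (F n) d \<and>
    (\<forall>(A, i)\<in>z_index n. d (z A i) = 1))"

definition theta :: "nat \<Rightarrow> 'k::field zpoly \<Rightarrow> 'k zpoly"
  where "theta n = (THE t. t \<in> extensional (carrier (F n)) \<and> antiautomorphism (F n) t \<and>
    (\<forall>(A, i)\<in>z_index n. t (z A i) = z ({1..n} - (A \<union> {i})) i))"


section \<open>Well-definedness\<close>

lemma free_algebra_simps:
  "carrier (free_algebra G) = {p. \<forall>w\<in>Poly_Mapping.keys p. set (letters w) \<subseteq> G}"
  "mult (free_algebra G) = (*)" "one (free_algebra G) = 1" "zero (free_algebra G) = 0"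
  "add (free_algebra G) = (+)"
  "smult (free_algebra G) c p = Poly_Mapping.single 0 c * p"
  by (simp_all add: free_algebra_def mult_map_scale_conv_mult)

lemma carrier_add:
  "p \<in> carrier (free_algebra G) \<Longrightarrow> q \<in> carrier (free_algebra G) \<Longrightarrow> p + q \<in> carrier (free_algebra G)"
  using keys_add[of p q] by (auto simp: free_algebra_simps)

lemma carrier_uminus: "p \<in> carrier (free_algebra G) \<Longrightarrow> - p \<in> carrier (free_algebra G)"
  by (auto simp: free_algebra_simps in_keys_iff)

lemma carrier_single: "set us \<subseteq> G \<Longrightarrow> Poly_Mapping.single (Word us) c \<in> carrier (free_algebra G)"
  by (auto simp: free_algebra_simps)

lemma carrier_0: "0 \<in> carrier (free_algebra G)"
  by (auto simp: free_algebra_simps)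

lemma carrier_mult:
  "p \<in> carrier (free_algebra G) \<Longrightarrow> q \<in> carrier (free_algebra G) \<Longrightarrow> p * q \<in> carrier (free_algebra G)"
  using keys_mult[of p q] by (fastforce simp: free_algebra_simps plus_word_def)

lemma carrier_1: "1 \<in> carrier (free_algebra G)"
  by (auto simp: free_algebra_simps zero_word_def)

lemma carrier_sum:
  "(\<And>x. x \<in> S \<Longrightarrow> f x \<in> carrier (free_algebra G)) \<Longrightarrow> sum f S \<in> carrier (free_algebra G)"
  by (induction S rule: infinite_finite_induct) (auto intro: carrier_add carrier_0)

lemma ring_free_algebra: "ring (free_algebra G :: ('k::field, ('g, 'k) ncpoly) module)"
  (is "ring ?R")
proof (rule ringI)
  show "abelian_group ?R"
  proof (rule abelian_groupI)
    fix p :: "('g, 'k) ncpoly" assume "p \<in> carrier ?R"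
    then show "\<exists>q\<in>carrier ?R. q \<oplus>\<^bsub>?R\<^esub> p = \<zero>\<^bsub>?R\<^esub>"
      by (intro bexI[of _ "- p"] carrier_uminus) (auto simp: free_algebra_simps)
  qed (auto simp: free_algebra_simps(2-5) algebra_simps intro: carrier_add carrier_0)
  show "monoid ?R"
    by (rule monoidI)
      (auto simp: free_algebra_simps(2-5) algebra_simps intro: carrier_mult carrier_1)
qed (auto simp: free_algebra_simps(2-5) algebra_simps)

lemma sum_singles: "p = (\<Sum>w\<in>Poly_Mapping.keys p. Poly_Mapping.single w (Poly_Mapping.lookup p w))"
  by (rule poly_mapping_eqI)
    (auto simp: lookup_sum lookup_single when_def sum.delta in_keys_iff)

lemma scalar_commute: "Poly_Mapping.single 0 c * p = p * Poly_Mapping.single 0 c"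
  for p :: "('g, 'k::field) ncpoly"
proof -
  have "Poly_Mapping.single 0 c * Poly_Mapping.single w a = Poly_Mapping.single w a * Poly_Mapping.single 0 c"
    for w :: "'g word" and a by (simp add: mult_single mult.commute)
  then show ?thesis
    by (subst (1 2) sum_singles[of p]) (simp add: sum_distrib_left sum_distrib_right)
qed

lemma scalar_left_commute: "p * (Poly_Mapping.single 0 c * q) = Poly_Mapping.single 0 c * (p * q)"
  for p q :: "('g, 'k::field) ncpoly"
  by (simp only: mult.assoc[symmetric] scalar_commute[of c p])

definition lin :: "('g word \<Rightarrow> ('g, 'k::field) ncpoly) \<Rightarrow> ('g, 'k) ncpoly \<Rightarrow> ('g, 'k) ncpoly"
  where "lin f p = (\<Sum>w\<in>Poly_Mapping.keys p. Poly_Mapping.single 0 (Poly_Mapping.lookup p w) * f w)"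

lemma lin_superset:
  assumes "finite S" "Poly_Mapping.keys p \<subseteq> S"
  shows "lin f p = (\<Sum>w\<in>S. Poly_Mapping.single 0 (Poly_Mapping.lookup p w) * f w)"
  unfolding lin_def by (rule sum.mono_neutral_left) (use assms in \<open>auto simp: in_keys_iff\<close>)

lemma lin_add: "lin f (p + q) = lin f p + lin f q"
proof -
  let ?S = "Poly_Mapping.keys p \<union> Poly_Mapping.keys q"
  show ?thesis
    by (subst (1 2 3) lin_superset[of ?S])
      (use keys_add[of p q] in \<open>auto simp: lookup_add single_add algebra_simps sum.distrib\<close>)
qed

lemma lin_0: "lin f 0 = 0"
  by (simp add: lin_def)

lemma lin_sum: "lin f (sum g S) = (\<Sum>x\<in>S. lin f (g x))"
  by (induction S rule: infinite_finite_induct) (auto simp: lin_0 lin_add)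

lemma lin_single: "lin f (Poly_Mapping.single w c) = Poly_Mapping.single 0 c * f w"
  by (cases "c = 0") (auto simp: lin_def)

lemma lin_scale: "lin f (Poly_Mapping.single 0 c * p) = Poly_Mapping.single 0 c * lin f p"
proof -
  have "lin f (Poly_Mapping.single 0 c * Poly_Mapping.single w a) =
      Poly_Mapping.single 0 c * lin f (Poly_Mapping.single w a)" for w a
    by (simp add: lin_single mult_single mult.assoc[symmetric])
  then show ?thesis
    by (subst (1 2) sum_singles[of p]) (simp add: sum_distrib_left lin_sum)
qed

lemma lin_carrier:
  assumes "p \<in> carrier (free_algebra G)" "\<And>us. set us \<subseteq> G \<Longrightarrow> f (Word us) \<in> carrier (free_algebra G)"
  shows "lin f p \<in> carrier (free_algebra G)"
proof -
  have "f w \<in> carrier (free_algebra G)" if "w \<in> Poly_Mapping.keys p" for w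
    using assms that by (cases w) (force simp: free_algebra_simps(1))
  then show ?thesis
    unfolding lin_def zero_word_def by (intro carrier_sum carrier_mult carrier_single) auto
qed

lemma lin_linear_endo:
  fixes f :: "'g word \<Rightarrow> ('g, 'k::field) ncpoly"
  assumes "\<And>us. set us \<subseteq> G \<Longrightarrow> f (Word us) \<in> carrier (free_algebra G)"
  shows "linear_endo (free_algebra G) (restrict (lin f) (carrier (free_algebra G)))"
proof -
  have "Poly_Mapping.single 0 c * p \<in> carrier (free_algebra G)"
    if "p \<in> carrier (free_algebra G)" for c and p :: "('g, 'k) ncpoly"
    using that unfolding zero_word_def by (intro carrier_mult carrier_single) auto
  then show ?thesis
    using assms by (auto simp: linear_endo_def free_algebra_simps(2-6) lin_add lin_scale
        intro: lin_carrier carrier_add)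
qed

lemma linear_endo_eqI:
  fixes f g :: "('g, 'k::field) ncpoly \<Rightarrow> ('g, 'k) ncpoly"
  assumes f: "linear_endo (free_algebra G) f" and g: "linear_endo (free_algebra G) g"
    and eq: "\<And>us. set us \<subseteq> G \<Longrightarrow> f (Poly_Mapping.single (Word us) 1) = g (Poly_Mapping.single (Word us) 1)"
    and p: "p \<in> carrier (free_algebra G)"
  shows "f p = g p"
proof -
  let ?C = "carrier (free_algebra G) :: ('g, 'k) ncpoly set"
  have add: "h (a + b) = h a + h b" if "linear_endo (free_algebra G) h" "a \<in> ?C" "b \<in> ?C" for h a b
    using that by (auto simp: linear_endo_def free_algebra_simps(5))
  have scale: "h (Poly_Mapping.single 0 c * a) = Poly_Mapping.single 0 c * h a"
    if "linear_endo (free_algebra G) h" "a \<in> ?C" for h a c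
    using that by (auto simp: linear_endo_def free_algebra_simps(6))
  have mono: "f (Poly_Mapping.single w c) = g (Poly_Mapping.single w c)"
    if "set (letters w) \<subseteq> G" for w c
  proof -
    have "Poly_Mapping.single w c = Poly_Mapping.single 0 c * Poly_Mapping.single w 1"
      by (simp add: mult_single)
    moreover have "Poly_Mapping.single w 1 \<in> ?C"
      using that carrier_single[of "letters w" G 1] by simp
    ultimately show ?thesis
      using scale[OF f] scale[OF g] eq[of "letters w"] that by simp
  qed
  have zero: "f 0 = 0" "g 0 = 0"
    using add[OF f carrier_0 carrier_0] add[OF g carrier_0 carrier_0] by simp_all
  have "f (sum h S) = g (sum h S)"
    if "finite S" "\<And>x. x \<in> S \<Longrightarrow> h x \<in> ?C \<and> f (h x) = g (h x)" for h and S :: "'g word set"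
    using that
    by (induction S rule: finite_induct) (simp_all add: zero add[OF f] add[OF g] carrier_sum)
  moreover have "Poly_Mapping.single w c \<in> ?C" if "set (letters w) \<subseteq> G" for w c
    using that carrier_single[of "letters w" G c] by simp
  ultimately show ?thesis
    by (subst (1 2) sum_singles[of p]) (use p mono in \<open>auto simp: free_algebra_simps(1)\<close>)
qed

lemma single_Cons: "Poly_Mapping.single (Word (x # us)) 1 = var x * Poly_Mapping.single (Word us) 1"
  by (simp add: var_def mult_single plus_word_def)

lemma single_Nil: "Poly_Mapping.single (Word []) 1 = 1"
  by (simp flip: zero_word_def)

lemma var_carrier: "g \<in> G \<Longrightarrow> var g \<in> carrier (free_algebra G)"
  unfolding var_def by (rule carrier_single) simp

lemma lin_biadditive:
  fixes f :: "'g word \<Rightarrow> ('g, 'k::field) ncpoly"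
  assumes "\<And>u v. lin f (Poly_Mapping.single (u + v) 1) =
      b (Poly_Mapping.single u 1) (Poly_Mapping.single v 1)"
    and "\<And>p q r. b (p + q) r = b p r + b q r" "\<And>p q r. b r (p + q) = b r p + b r q"
    and "\<And>c p q. b (Poly_Mapping.single 0 c * p) q = Poly_Mapping.single 0 c * b p q"
    and "\<And>c p q. b p (Poly_Mapping.single 0 c * q) = Poly_Mapping.single 0 c * b p q"
  shows "lin f (p * q) = b p q"
proof -
  have z: "b 0 r = 0" "b r 0 = 0" for r
    using assms(2)[of 0 0 r] assms(3)[of r 0 0] by simp_all
  have s: "b (sum g S) r = (\<Sum>x\<in>S. b (g x) r)" "b r (sum g S) = (\<Sum>x\<in>S. b r (g x))"
    for g r and S :: "'g word set"
    by (induction S rule: infinite_finite_induct; simp add: z assms(2,3))+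
  have m: "lin f (Poly_Mapping.single u c * Poly_Mapping.single v d) =
      b (Poly_Mapping.single u c) (Poly_Mapping.single v d)" for u v c d
  proof -
    have e: "Poly_Mapping.single w a = Poly_Mapping.single 0 a * Poly_Mapping.single w 1"
      for w :: "'g word" and a :: 'k
      by (simp add: mult_single)
    have "b (Poly_Mapping.single u c) (Poly_Mapping.single v d) =
      Poly_Mapping.single 0 c * (Poly_Mapping.single 0 d *
        b (Poly_Mapping.single u 1) (Poly_Mapping.single v 1))"
      by (subst e[of u], subst e[of v], subst assms(4), subst assms(5)) (rule refl)
    also have "\<dots> = Poly_Mapping.single 0 (c * d) * lin f (Poly_Mapping.single (u + v) 1)"
      by (simp add: assms(1) mult.assoc[symmetric] mult_single)
    finally show ?thesis
      by (simp add: lin_single mult_single)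
  qed
  have "lin f (p * q) = (\<Sum>u\<in>Poly_Mapping.keys p. \<Sum>v\<in>Poly_Mapping.keys q.
     lin f (Poly_Mapping.single u (Poly_Mapping.lookup p u) * Poly_Mapping.single v (Poly_Mapping.lookup q v)))"
    by (subst sum_singles[of p], subst sum_singles[of q])
      (simp only: sum_distrib_left sum_distrib_right lin_sum sum.swap[of _ "Poly_Mapping.keys q"])
  also have "\<dots> = b (\<Sum>u\<in>Poly_Mapping.keys p. Poly_Mapping.single u (Poly_Mapping.lookup p u))
      (\<Sum>v\<in>Poly_Mapping.keys q. Poly_Mapping.single v (Poly_Mapping.lookup q v))"
    unfolding m s(1) by (simp only: s(2))
  finally show ?thesis
    by (simp only: sum_singles[symmetric])
qed

subsection \<open>Derivations\<close>

primrec dword :: "'g list \<Rightarrow> ('g, 'k::field) ncpoly" where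
  "dword [] = 0"
| "dword (x # us) = Poly_Mapping.single (Word us) 1 + var x * dword us"

lemma single_append:
  "Poly_Mapping.single (Word (us @ vs)) 1 =
    Poly_Mapping.single (Word us) 1 * (Poly_Mapping.single (Word vs) 1 :: ('g, 'k::field) ncpoly)"
  by (simp add: mult_single plus_word_def)

lemma dword_append:
  "dword (us @ vs) = dword us * Poly_Mapping.single (Word vs) 1 + Poly_Mapping.single (Word us) 1 * dword vs"
  by (induction us) (simp_all add: single_Nil single_Cons single_append algebra_simps)

lemma dword_carrier: "set us \<subseteq> G \<Longrightarrow> dword us \<in> carrier (free_algebra G)"
  by (induction us) (auto intro!: carrier_0 carrier_add carrier_single carrier_mult var_carrier)

lemma lin_dword_mult:
  "lin (dword \<circ> letters) (p * q) = lin (dword \<circ> letters) p * q + p * lin (dword \<circ> letters) q"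
  for p q :: "('g, 'k::field) ncpoly"
proof (rule lin_biadditive)
  fix u v :: "'g word"
  show "lin (dword \<circ> letters) (Poly_Mapping.single (u + v) 1) =
      lin (dword \<circ> letters) (Poly_Mapping.single u 1) * Poly_Mapping.single v 1 +
      Poly_Mapping.single u 1 * (lin (dword \<circ> letters) (Poly_Mapping.single v 1) :: ('g, 'k) ncpoly)"
    by (cases u; cases v) (simp add: lin_single dword_append plus_word_def)
next
  fix c p q
  show "lin (dword \<circ> letters) p * (Poly_Mapping.single 0 c * q) +
      p * lin (dword \<circ> letters) (Poly_Mapping.single 0 c * q) =
    Poly_Mapping.single 0 c * (lin (dword \<circ> letters) p * q + p * lin (dword \<circ> letters) q)"
    by (simp add: lin_scale distrib_left scalar_left_commute mult.assoc)
qed (simp_all add: lin_add lin_scale algebra_simps)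

lemma derivation_ex1:
  "\<exists>!d. d \<in> extensional (carrier (free_algebra G)) \<and> derivation (free_algebra G) d \<and>
    (\<forall>g\<in>G. d (var g :: ('g, 'k::field) ncpoly) = 1)"
proof (rule ex_ex1I)
  let ?C = "carrier (free_algebra G) :: ('g, 'k) ncpoly set"
  let ?d = "restrict (lin (dword \<circ> letters)) ?C"
  have "derivation (free_algebra G) ?d"
    unfolding derivation_def
  proof (intro conjI lin_linear_endo ballI)
    fix a b assume "a \<in> ?C" "b \<in> ?C"
    then show "?d (a \<otimes>\<^bsub>free_algebra G\<^esub> b) =
        ?d a \<otimes>\<^bsub>free_algebra G\<^esub> b \<oplus>\<^bsub>free_algebra G\<^esub> a \<otimes>\<^bsub>free_algebra G\<^esub> ?d b"
      using carrier_mult[of a G b] by (simp add: free_algebra_simps(2-5) lin_dword_mult)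
  qed (simp add: dword_carrier)
  moreover have "?d (var g) = 1" if "g \<in> G" for g
  proof -
    have "var g \<in> ?C" by (rule var_carrier[OF that])
    then show ?thesis by (simp add: lin_single var_def single_Nil)
  qed
  ultimately show "\<exists>d. d \<in> extensional ?C \<and> derivation (free_algebra G) d \<and> (\<forall>g\<in>G. d (var g) = 1)"
    by (intro exI[of _ ?d]) auto
next
  let ?C = "carrier (free_algebra G) :: ('g, 'k) ncpoly set"
  fix d e :: "('g, 'k) ncpoly \<Rightarrow> ('g, 'k) ncpoly"
  assume d: "d \<in> extensional ?C \<and> derivation (free_algebra G) d \<and> (\<forall>g\<in>G. d (var g) = 1)"
    and e: "e \<in> extensional ?C \<and> derivation (free_algebra G) e \<and> (\<forall>g\<in>G. e (var g) = 1)"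
  have leib: "h (a * b) = h a * b + a * h b"
    if "derivation (free_algebra G) h" "a \<in> ?C" "b \<in> ?C" for h a b
    using that by (auto simp: derivation_def free_algebra_simps(2-5))
  have one: "h 1 = 0" if "derivation (free_algebra G) h" for h :: "('g, 'k) ncpoly \<Rightarrow> ('g, 'k) ncpoly"
    using leib[OF that carrier_1 carrier_1] by simp
  have mono: "d (Poly_Mapping.single (Word us) 1) = e (Poly_Mapping.single (Word us) 1)"
    if "set us \<subseteq> G" for us
    using that
  proof (induction us)
    case Nil
    then show ?case using d e by (simp add: single_Nil one)
  next
    case (Cons x us)
    then have "var x \<in> ?C" "Poly_Mapping.single (Word us) 1 \<in> ?C"
      by (auto intro: var_carrier carrier_single)
    with Cons d e show ?case by (simp add: single_Cons leib)
  qed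
  show "d = e"
  proof (rule extensionalityI)
    fix p assume "p \<in> ?C"
    with mono d e show "d p = e p" by (auto intro: linear_endo_eqI simp: derivation_def)
  qed (use d e in auto)
qed

theorem del_ex1:
  "\<exists>!d. d \<in> extensional (carrier (F n)) \<and> derivation (F n) d \<and>
    (\<forall>(A, i)\<in>z_index n. d (z A i :: 'k::field zpoly) = 1)"
  using derivation_ex1[of "z_index n"] by (simp add: F_def z_def split_def)

subsection \<open>Antiautomorphisms\<close>

definition rword :: "('g \<Rightarrow> 'g) \<Rightarrow> 'g list \<Rightarrow> ('g, 'k::field) ncpoly"
  where "rword s us = Poly_Mapping.single (Word (rev (map s us))) 1"

lemma lin_rword_mult: "lin (rword s \<circ> letters) (p * q) = lin (rword s \<circ> letters) q * lin (rword s \<circ> letters) p"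
  for p q :: "('g, 'k::field) ncpoly"
proof (rule lin_biadditive)
  fix u v :: "'g word"
  show "lin (rword s \<circ> letters) (Poly_Mapping.single (u + v) 1) =
      lin (rword s \<circ> letters) (Poly_Mapping.single v 1) *
      (lin (rword s \<circ> letters) (Poly_Mapping.single u 1) :: ('g, 'k) ncpoly)"
    by (cases u; cases v) (simp add: lin_single rword_def plus_word_def mult_single)
next
  fix c p q
  show "lin (rword s \<circ> letters) q * lin (rword s \<circ> letters) (Poly_Mapping.single 0 c * p) =
     Poly_Mapping.single 0 c * (lin (rword s \<circ> letters) q * lin (rword s \<circ> letters) p)"
    by (simp add: lin_scale scalar_left_commute)
qed (simp_all add: lin_add lin_scale algebra_simps)

lemma lin_rword_invol:
  fixes p :: "('g, 'k::field) ncpoly"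
  assumes "p \<in> carrier (free_algebra G)" "\<And>g. g \<in> G \<Longrightarrow> s (s g) = g"
  shows "lin (rword s \<circ> letters) (lin (rword s \<circ> letters) p) = p"
proof -
  have "lin (rword s \<circ> letters) (lin (rword s \<circ> letters) (Poly_Mapping.single w c)) = Poly_Mapping.single w c"
    if "set (letters w) \<subseteq> G" for w and c :: 'k
  proof -
    have "map (\<lambda>x. s (s x)) (letters w) = letters w"
      using that assms(2) by (intro map_idI) auto
    then show ?thesis
      by (cases w) (simp add: lin_single rword_def mult_single rev_map o_def)
  qed
  with assms(1) show ?thesis
    by (subst (1 2) sum_singles[of p]) (auto simp: lin_sum free_algebra_simps(1) intro!: sum.cong)
qed

lemma antiautomorphism_ex1:
  assumes s: "\<And>g. g \<in> G \<Longrightarrow> s g \<in> G \<and> s (s g) = g"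
  shows "\<exists>!t. t \<in> extensional (carrier (free_algebra G)) \<and> antiautomorphism (free_algebra G) t \<and>
    (\<forall>g\<in>G. t (var g :: ('g, 'k::field) ncpoly) = var (s g))"
proof (rule ex_ex1I)
  let ?C = "carrier (free_algebra G) :: ('g, 'k) ncpoly set"
  let ?l = "lin (rword s \<circ> letters) :: ('g, 'k) ncpoly \<Rightarrow> ('g, 'k) ncpoly"
  let ?t = "restrict ?l ?C"
  have rc: "(rword s \<circ> letters) (Word us) \<in> carrier (free_algebra G)" if "set us \<subseteq> G" for us
    using that s unfolding rword_def o_def word.sel by (intro carrier_single) auto
  have lc: "?l p \<in> ?C" if "p \<in> ?C" for p
    using lin_carrier[OF that, of "rword s \<circ> letters"] rc by blast
  have inv: "?l (?l p) = p" if "p \<in> ?C" for p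
    using lin_rword_invol[OF that, of s] s by blast
  have "?l 1 = 1"
    using lin_single[of "rword s \<circ> letters" 0 1] by (simp add: rword_def zero_word_def single_Nil)
  moreover have "1 \<in> ?C"
    by (rule carrier_1)
  ultimately have one: "?t 1 = 1"
    by (simp only: restrict_apply if_True)
  have "antiautomorphism (free_algebra G) ?t"
    unfolding antiautomorphism_def
  proof (intro conjI lin_linear_endo ballI)
    show "bij_betw ?t ?C ?C"
      by (rule bij_betw_byWitness[where f' = ?t]) (auto simp: lc inv)
    show "?t \<one>\<^bsub>free_algebra G\<^esub> = \<one>\<^bsub>free_algebra G\<^esub>"
      unfolding free_algebra_simps(3) by (rule one)
    fix a b assume "a \<in> ?C" "b \<in> ?C"
    then show "?t (a \<otimes>\<^bsub>free_algebra G\<^esub> b) = ?t b \<otimes>\<^bsub>free_algebra G\<^esub> ?t a"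
      using carrier_mult[of a G b] by (simp add: free_algebra_simps(2-5) lin_rword_mult)
  qed (use rc in auto)
  moreover have "?t (var g) = var (s g)" if "g \<in> G" for g
  proof -
    have "var g \<in> ?C" by (rule var_carrier[OF that])
    then show ?thesis by (simp add: lin_single var_def rword_def)
  qed
  ultimately show "\<exists>t. t \<in> extensional ?C \<and> antiautomorphism (free_algebra G) t \<and>
      (\<forall>g\<in>G. t (var g) = var (s g))"
    by (intro exI[of _ ?t]) auto
next
  let ?C = "carrier (free_algebra G) :: ('g, 'k) ncpoly set"
  fix d e :: "('g, 'k) ncpoly \<Rightarrow> ('g, 'k) ncpoly"
  assume d: "d \<in> extensional ?C \<and> antiautomorphism (free_algebra G) d \<and> (\<forall>g\<in>G. d (var g) = var (s g))"
    and e: "e \<in> extensional ?C \<and> antiautomorphism (free_algebra G) e \<and> (\<forall>g\<in>G. e (var g) = var (s g))"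
  have mult: "h (a * b) = h b * h a"
    if "antiautomorphism (free_algebra G) h" "a \<in> ?C" "b \<in> ?C" for h a b
    using that by (auto simp: antiautomorphism_def free_algebra_simps(2-5))
  have one: "h 1 = 1" if "antiautomorphism (free_algebra G) h" for h :: "('g, 'k) ncpoly \<Rightarrow> ('g, 'k) ncpoly"
    using that by (auto simp: antiautomorphism_def free_algebra_simps(2-5))
  have mono: "d (Poly_Mapping.single (Word us) 1) = e (Poly_Mapping.single (Word us) 1)"
    if "set us \<subseteq> G" for us
    using that
  proof (induction us)
    case Nil
    then show ?case using d e by (simp add: single_Nil one)
  next
    case (Cons x us)
    then have "var x \<in> ?C" "Poly_Mapping.single (Word us) 1 \<in> ?C"
      by (auto intro: var_carrier carrier_single)
    with Cons d e show ?case by (simp add: single_Cons mult)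
  qed
  show "d = e"
  proof (rule extensionalityI)
    fix p assume "p \<in> ?C"
    with mono d e show "d p = e p" by (auto intro: linear_endo_eqI simp: antiautomorphism_def)
  qed (use d e in auto)
qed

theorem theta_ex1:
  "\<exists>!t. t \<in> extensional (carrier (F n)) \<and> antiautomorphism (F n) t \<and>
    (\<forall>(A, i)\<in>z_index n. t (z A i :: 'k::field zpoly) = z ({1..n} - (A \<union> {i})) i)"
proof -
  let ?s = "\<lambda>(A, i). ({1..n} - (A \<union> {i}), i)"
  have "?s g \<in> z_index n \<and> ?s (?s g) = g" if "g \<in> z_index n" for g
    using that by (auto simp: z_index_def)
  from antiautomorphism_ex1[of "z_index n" ?s, OF this] show ?thesis
    by (simp add: F_def z_def split_def)
qed

subsection \<open>The quotient algebra\<close>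

lemma J_gens_carrier: "J_gens n \<subseteq> carrier (F n)"
proof -
  have v: "z A i \<in> carrier (F n)" if "(A, i) \<in> z_index n" for A i
    using that unfolding F_def z_def by (rule var_carrier)
  have m: "p - q \<in> carrier (F n)" if "p \<in> carrier (F n)" "q \<in> carrier (F n)" for p q :: "'a zpoly"
    using that carrier_add[of p _ "- q"] carrier_uminus[of q] by (simp add: F_def)
  show ?thesis
    unfolding J_gens_def
    by (auto intro!: m carrier_add[of _ "z_index n", folded F_def]
        carrier_mult[of _ "z_index n", folded F_def] v) (auto simp: z_index_def)
qed

lemma ideal_J: "ideal (J n) (F n)"
  unfolding J_def using ring.genideal_ideal[OF ring_free_algebra] J_gens_carrier
  unfolding F_def by blast

lemma Q_simps:
  "carrier (Q n) = a_rcosets\<^bsub>F n\<^esub> (J n)" "mult (Q n) = rcoset_mult (F n) (J n)"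
  "one (Q n) = J n +>\<^bsub>F n\<^esub> 1" "zero (Q n) = J n" "add (Q n) = set_add (F n)"
  "smult (Q n) c X = (\<Union>x\<in>X. J n +>\<^bsub>F n\<^esub> (Poly_Mapping.single 0 c * x))"
  by (simp_all add: Q_def quotient_algebra_def ring.extend_def module.fields_def FactRing_def
      F_def free_algebra_simps)

lemma Q_smult:
  assumes x: "x \<in> carrier (F n)"
  shows "c \<odot>\<^bsub>Q n\<^esub> (J n +>\<^bsub>F n\<^esub> x) = J n +>\<^bsub>F n\<^esub> (c \<odot>\<^bsub>F n\<^esub> x)"
proof -
  interpret ideal "J n :: 'a zpoly set" "F n" by (rule ideal_J)
  have sc: "c \<odot>\<^bsub>F n\<^esub> y = Poly_Mapping.single 0 c \<otimes>\<^bsub>F n\<^esub> y" for y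
    by (simp add: F_def free_algebra_simps)
  have c: "Poly_Mapping.single 0 c \<in> carrier (F n)"
    unfolding F_def zero_word_def by (rule carrier_single) simp
  have eq: "J n +>\<^bsub>F n\<^esub> (Poly_Mapping.single 0 c \<otimes>\<^bsub>F n\<^esub> y) =
      J n +>\<^bsub>F n\<^esub> (Poly_Mapping.single 0 c \<otimes>\<^bsub>F n\<^esub> x)" if y: "y \<in> J n +>\<^bsub>F n\<^esub> x" for y
  proof -
    have yc: "y \<in> carrier (F n)" using y x a_r_coset_subset_G[OF a_subset] by blast
    have "J n +>\<^bsub>F n\<^esub> y = J n +>\<^bsub>F n\<^esub> x"
      using a_repr_independence[OF y x] a_subgroup by simp
    then show ?thesis
      using rcoset_mult_add[OF c yc] rcoset_mult_add[OF c x] by simp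
  qed
  have "J n +>\<^bsub>F n\<^esub> x \<noteq> {}" using a_rcos_self[OF x] by blast
  moreover have "c \<odot>\<^bsub>Q n\<^esub> (J n +>\<^bsub>F n\<^esub> x) =
      (\<Union>y\<in>J n +>\<^bsub>F n\<^esub> x. J n +>\<^bsub>F n\<^esub> (Poly_Mapping.single 0 c \<otimes>\<^bsub>F n\<^esub> y))"
    unfolding Q_simps F_def free_algebra_simps(2) ..
  moreover have "\<dots> = (\<Union>y\<in>J n +>\<^bsub>F n\<^esub> x. J n +>\<^bsub>F n\<^esub> (Poly_Mapping.single 0 c \<otimes>\<^bsub>F n\<^esub> x))"
    by (rule SUP_cong[OF refl eq])
  ultimately show ?thesis
    unfolding sc by (simp only: UN_constant if_False)
qed

end

theory Submission
  imports Defs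
begin

text \<open>
  An additive map that is compatible with multiplication by arbitrary elements preserves a
  two-sided ideal as soon as it sends the generators into the ideal
  (\<open>genideal_invariant\<close>); both parts therefore reduce to a computation on the generators of
  \<open>J n\<close>.

  The derivation sends each linear generator to \<open>1 + 1 - 1 - 1 = 0\<close>.  By the Leibniz
  rule it sends the quadratic generator for \<open>(A, i, j)\<close> to the linear one for the same data.

  The antiautomorphism permutes the generators.  Put \<open>B = {1..n} - (A \<union> {i, j})\<close>.  Taking
  complements turns the two paths \<open>A \<subset> A \<union> {i} \<subset> A \<union> {i, j}\<close> and
  \<open>A \<subset> A \<union> {j} \<subset> A \<union> {i, j}\<close> into the two paths from \<open>B\<close> to \<open>B \<union> {i, j}\<close>, traversed
  backwards; reversing the order of the factors restores their direction.  Hence the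
  generators for \<open>(A, i, j)\<close> go to those for \<open>(B, j, i)\<close>.  As complementation is an
  involution, so is \<open>theta n\<close>, and the inclusion \<open>theta n ` J n \<subseteq> J n\<close> is an equality.

  A linear map preserving \<open>J n\<close> acts on cosets (\<open>coset_map\<close>), and the identities defining
  derivations and antiautomorphisms pass to this action because the operations of \<open>Q n\<close> are
  computed on representatives.
\<close>

section \<open>Maps preserving an ideal given by generators\<close>

text \<open>
  The elements of the ideal whose image lies in the ideal again form an ideal, and this
  contains the generators.  The multiplicative hypotheses may use that \<open>f x\<close> is already in the
  ideal, which is what makes them hold for derivations, where \<open>x\<close> and \<open>f x\<close> both occur in the
  expansion of \<open>f (a \<otimes> x)\<close>.
\<close>

lemma genideal_invariant:
  fixes R :: "('k::field, 'a) module" (structure)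
  assumes "ring R" and S: "S \<subseteq> carrier R" and f: "linear_endo R f"
    and gens: "\<And>x. x \<in> S \<Longrightarrow> f x \<in> Idl S"
    and left: "\<And>a x. a \<in> carrier R \<Longrightarrow> x \<in> Idl S \<Longrightarrow> f x \<in> Idl S \<Longrightarrow> f (a \<otimes> x) \<in> Idl S"
    and right: "\<And>a x. a \<in> carrier R \<Longrightarrow> x \<in> Idl S \<Longrightarrow> f x \<in> Idl S \<Longrightarrow> f (x \<otimes> a) \<in> Idl S"
  shows "f ` (Idl S) \<subseteq> Idl S"
proof -
  interpret ring R by fact
  interpret I: ideal "Idl S" R by (rule genideal_ideal[OF S])
  have closed: "f a \<in> carrier R" if "a \<in> carrier R" for a
    using f that by (auto simp: linear_endo_def)
  have add: "f (a \<oplus> b) = f a \<oplus> f b" if "a \<in> carrier R" "b \<in> carrier R" for a b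
    using f that by (auto simp: linear_endo_def)
  have zero: "f \<zero> = \<zero>"
    using add[of \<zero> \<zero>] closed[of \<zero>] by simp
  have minus: "f (\<ominus> a) = \<ominus> f a" if a: "a \<in> carrier R" for a
    using add[of "\<ominus> a" a] a closed by (simp add: zero l_neg minus_equality)
  have "ideal {x \<in> Idl S. f x \<in> Idl S} R"
  proof (rule idealI)
    show "subgroup {x \<in> Idl S. f x \<in> Idl S} (add_monoid R)"
      by (rule add.subgroupI)
        (auto simp: add minus I.Icarr zero simp flip: a_inv_def intro!: exI[of _ \<zero>])
  qed (auto simp: left right I.I_l_closed I.I_r_closed \<open>ring R\<close>)
  from genideal_minimal[OF this] show ?thesis
    using gens genideal_self[OF S] by blast
qed

section \<open>The derivation and the antiautomorphism on generators\<close>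

lemma F_simps:
  "mult (F n) = (*)" "one (F n) = 1" "zero (F n) = 0" "add (F n) = (+)"
  by (simp_all add: F_def free_algebra_simps)

lemma ring_F: "ring (F n)"
  unfolding F_def by (rule ring_free_algebra)

lemma F_add: "p \<in> carrier (F n) \<Longrightarrow> q \<in> carrier (F n) \<Longrightarrow> p + q \<in> carrier (F n)"
  unfolding F_def by (rule carrier_add)

lemma F_mult: "p \<in> carrier (F n) \<Longrightarrow> q \<in> carrier (F n) \<Longrightarrow> p * q \<in> carrier (F n)"
  unfolding F_def by (rule carrier_mult)

lemma F_minus: "p \<in> carrier (F n) \<Longrightarrow> q \<in> carrier (F n) \<Longrightarrow> p - q \<in> carrier (F n)"
  using carrier_add[of p "z_index n" "- q"] carrier_uminus[of q] by (simp add: F_def)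

lemma z_carrier: "(A, i) \<in> z_index n \<Longrightarrow> z A i \<in> carrier (F n)"
  unfolding F_def z_def by (rule var_carrier)

lemma linear_endo_closed: "linear_endo (F n) f \<Longrightarrow> p \<in> carrier (F n) \<Longrightarrow> f p \<in> carrier (F n)"
  by (auto simp: linear_endo_def)

lemma linear_endo_add:
  "linear_endo (F n) f \<Longrightarrow> p \<in> carrier (F n) \<Longrightarrow> q \<in> carrier (F n) \<Longrightarrow> f (p + q) = f p + f q"
  by (auto simp: linear_endo_def F_simps)

lemma linear_endo_minus:
  assumes "linear_endo (F n) f" "p \<in> carrier (F n)" "q \<in> carrier (F n)"
  shows "f (p - q) = f p - f q"
  using linear_endo_add[OF assms(1) F_minus[OF assms(2,3)] assms(3)] by (simp add: algebra_simps)

lemma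
  shows derivation_del: "derivation (F n) (del n)"
    and del_z: "(A, i) \<in> z_index n \<Longrightarrow> del n (z A i) = 1"
  using theI'[OF del_ex1[of n]] unfolding del_def by auto

lemma linear_endo_del: "linear_endo (F n) (del n)"
  using derivation_del by (auto simp: derivation_def)

lemma del_mult:
  "p \<in> carrier (F n) \<Longrightarrow> q \<in> carrier (F n) \<Longrightarrow> del n (p * q) = del n p * q + p * del n q"
  using derivation_del[of n] by (auto simp: derivation_def F_simps)

lemma
  shows antiautomorphism_theta: "antiautomorphism (F n) (theta n)"
    and theta_z: "(A, i) \<in> z_index n \<Longrightarrow> theta n (z A i) = z ({1..n} - (A \<union> {i})) i"
  using theI'[OF theta_ex1[of n]] unfolding theta_def by auto

lemma linear_endo_theta: "linear_endo (F n) (theta n)"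
  using antiautomorphism_theta by (auto simp: antiautomorphism_def)

lemma theta_mult:
  "p \<in> carrier (F n) \<Longrightarrow> q \<in> carrier (F n) \<Longrightarrow> theta n (p * q) = theta n q * theta n p"
  using antiautomorphism_theta[of n] by (auto simp: antiautomorphism_def F_simps)

lemma theta_one: "theta n 1 = 1"
  using antiautomorphism_theta[of n] by (auto simp: antiautomorphism_def F_simps)

text \<open>
  The square of an antiautomorphism is multiplicative, so it is determined by its values on the
  generators, and complementing twice fixes these.
\<close>

lemma theta_theta:
  fixes p :: "'k::field zpoly"
  assumes p: "p \<in> carrier (F n)"
  shows "theta n (theta n p) = p"
proof -
  have closed: "theta n q \<in> carrier (F n)" if "q \<in> carrier (F n)" for q :: "'k zpoly"
    using linear_endo_closed[OF linear_endo_theta that] .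
  have "linear_endo (F n) (\<lambda>q :: 'k zpoly. theta n (theta n q))"
    using linear_endo_theta[of n, where ?'a = 'k] by (auto simp: linear_endo_def Pi_iff)
  moreover have "linear_endo (F n) (\<lambda>q :: 'k zpoly. q)"
    by (auto simp: linear_endo_def)
  moreover have "theta n (theta n (Poly_Mapping.single (Word us) 1)) =
      (Poly_Mapping.single (Word us) 1 :: 'k zpoly)" if "set us \<subseteq> z_index n" for us
    using that
  proof (induction us)
    case Nil
    then show ?case by (simp add: single_Nil theta_one)
  next
    case (Cons x us)
    obtain A i where x: "x = (A, i)" by (cases x)
    have Ai: "(A, i) \<in> z_index n" using Cons.prems x by simp
    then have "({1..n} - (A \<union> {i}), i) \<in> z_index n" and "{1..n} - ({1..n} - (A \<union> {i}) \<union> {i}) = A"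
      by (auto simp: z_index_def)
    then have "theta n (theta n (z A i)) = (z A i :: 'k zpoly)"
      using Ai by (simp add: theta_z)
    moreover have "(Poly_Mapping.single (Word us) 1 :: 'k zpoly) \<in> carrier (F n)"
      using Cons.prems unfolding F_def by (intro carrier_single) simp
    ultimately show ?case
      using Cons z_carrier[OF Ai, where ?'a = 'k]
      by (simp add: x single_Cons closed theta_mult flip: z_def)
  qed
  ultimately show ?thesis
    using p unfolding F_def by (rule linear_endo_eqI)
qed

section \<open>Invariance of the relations\<close>

lemma J_gensE:
  assumes "x \<in> J_gens n"
  obtains (linear) A i j where "A \<subseteq> {1..n}" "i \<in> {1..n} - A" "j \<in> {1..n} - A" "i \<noteq> j"
      "x = z (A \<union> {i}) j + z A i - z (A \<union> {j}) i - z A j"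
    | (quadratic) A i j where "A \<subseteq> {1..n}" "i \<in> {1..n} - A" "j \<in> {1..n} - A" "i \<noteq> j"
      "x = z (A \<union> {i}) j * z A i - z (A \<union> {j}) i * z A j"
  using assms unfolding J_gens_def by blast

lemma square_indices:
  assumes "A \<subseteq> {1..n}" "i \<in> {1..n} - A" "j \<in> {1..n} - A" "i \<noteq> j"
  shows "(A \<union> {i}, j) \<in> z_index n" "(A, i) \<in> z_index n" "(A \<union> {j}, i) \<in> z_index n" "(A, j) \<in> z_index n"
  using assms by (auto simp: z_index_def)

lemma J_gens_subset_J: "J_gens n \<subseteq> J n"
  unfolding J_def by (rule ring.genideal_self[OF ring_F J_gens_carrier])

lemma J_zero: "0 \<in> J n"
  using ideal.axioms(1)[OF ideal_J, THEN additive_subgroup.zero_closed] by (simp add: F_simps)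

lemma J_carrier: "x \<in> J n \<Longrightarrow> x \<in> carrier (F n)"
  using ideal_J additive_subgroup.a_Hcarr ideal.axioms(1) by metis

lemma J_add: "x \<in> J n \<Longrightarrow> y \<in> J n \<Longrightarrow> x + y \<in> J n"
  using additive_subgroup.a_closed[OF ideal.axioms(1)[OF ideal_J]] by (simp add: F_simps)

lemma J_mult:
  assumes "x \<in> J n" "a \<in> carrier (F n)"
  shows "a * x \<in> J n" "x * a \<in> J n"
  using ideal.I_l_closed[OF ideal_J assms] ideal.I_r_closed[OF ideal_J assms]
  by (simp_all add: F_simps)

text \<open>The Leibniz rule turns each quadratic relation into the linear relation for the same square.\<close>

lemma del_J_gens:
  fixes x :: "'k::field zpoly"
  assumes "x \<in> J_gens n"
  shows "del n x \<in> J n"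
  using assms
proof (cases rule: J_gensE)
  case (linear A i j)
  note idx = square_indices[OF linear(1-4)]
  have "del n x = 0"
    unfolding linear(5)
    by (simp add: linear_endo_add[OF linear_endo_del] linear_endo_minus[OF linear_endo_del]
        F_add F_minus z_carrier idx[simplified] del_z)
  then show ?thesis by (simp add: J_zero)
next
  case (quadratic A i j)
  note idx = square_indices[OF quadratic(1-4)]
  have "del n x = z (A \<union> {i}) j + z A i - z (A \<union> {j}) i - z A j"
    unfolding quadratic(5)
    by (simp add: linear_endo_minus[OF linear_endo_del] del_mult F_mult z_carrier
        idx[simplified] del_z)
  also have "\<dots> \<in> J_gens n"
    using quadratic(1-4) unfolding J_gens_def by blast
  finally show ?thesis using J_gens_subset_J by blast
qed

text \<open>
  Complementation exchanges the initial and the final vertex of the square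
  \<open>A\<close>, \<open>A \<union> {i}\<close>, \<open>A \<union> {j}\<close>, \<open>A \<union> {i, j}\<close>, which makes it the square on
  \<open>B = {1..n} - (A \<union> {i, j})\<close>.
\<close>

lemma theta_J_gens:
  fixes x :: "'k::field zpoly"
  assumes "x \<in> J_gens n"
  shows "theta n x \<in> J_gens n"
proof -
  have th: "theta n (z (A \<union> {i}) j) = (z B j :: 'k zpoly)"
       "theta n (z A i) = (z (B \<union> {j}) i :: 'k zpoly)"
    if "A \<subseteq> {1..n}" "i \<in> {1..n} - A" "j \<in> {1..n} - A" "i \<noteq> j" and B: "B = {1..n} - (A \<union> {i, j})"
    for A B i j
  proof -
    have "{1..n} - (A \<union> {i} \<union> {j}) = B" "{1..n} - (A \<union> {i}) = B \<union> {j}"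
      using that by auto
    then show "theta n (z (A \<union> {i}) j) = (z B j :: 'k zpoly)"
       "theta n (z A i) = (z (B \<union> {j}) i :: 'k zpoly)"
      using square_indices[OF that(1-4)] by (simp_all only: theta_z)
  qed
  show ?thesis
    using assms
  proof (cases rule: J_gensE)
    case (linear A i j)
    define B where "B = {1..n} - (A \<union> {i, j})"
    have B': "B = {1..n} - (A \<union> {j, i})" by (auto simp: B_def)
    note idx = square_indices[OF linear(1-4)]
    \<comment> \<open>The square is symmetric in its two paths, so the second path is treated by exchanging
      \<open>i\<close> and \<open>j\<close>.\<close>
    note th1 = th[OF linear(1-4) B_def] th[OF linear(1,3,2) linear(4)[symmetric] B']
    have "theta n x = z (B \<union> {j}) i + z B j - z (B \<union> {i}) j - z B i"
      unfolding linear(5)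
      by (simp only: linear_endo_add[OF linear_endo_theta] linear_endo_minus[OF linear_endo_theta]
          F_add F_minus z_carrier idx th1) simp
    moreover have "B \<subseteq> {1..n}" "i \<in> {1..n} - B" "j \<in> {1..n} - B"
      using linear by (auto simp: B_def)
    ultimately show ?thesis
      using linear(4) unfolding J_gens_def by blast
  next
    case (quadratic A i j)
    define B where "B = {1..n} - (A \<union> {i, j})"
    have B': "B = {1..n} - (A \<union> {j, i})" by (auto simp: B_def)
    note idx = square_indices[OF quadratic(1-4)]
    note th1 = th[OF quadratic(1-4) B_def] th[OF quadratic(1,3,2) quadratic(4)[symmetric] B']
    have "theta n x = z (B \<union> {j}) i * z B j - z (B \<union> {i}) j * z B i"
      unfolding quadratic(5)
      by (simp only: theta_mult linear_endo_minus[OF linear_endo_theta]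
          F_mult z_carrier idx th1)
    moreover have "B \<subseteq> {1..n}" "i \<in> {1..n} - B" "j \<in> {1..n} - B"
      using quadratic by (auto simp: B_def)
    ultimately show ?thesis
      using quadratic(4) unfolding J_gens_def by blast
  qed
qed

lemma del_J: "del n ` J n \<subseteq> (J n :: 'k::field zpoly set)"
  unfolding J_def
proof (rule genideal_invariant[OF ring_F J_gens_carrier linear_endo_del], fold J_def)
  fix a x :: "'k zpoly"
  assume *: "a \<in> carrier (F n)" "x \<in> J n" "del n x \<in> J n"
  then have "del n a \<in> carrier (F n)" by (simp add: linear_endo_closed[OF linear_endo_del])
  with * show "del n (a \<otimes>\<^bsub>F n\<^esub> x) \<in> J n" "del n (x \<otimes>\<^bsub>F n\<^esub> a) \<in> J n"
    by (simp_all add: F_simps del_mult J_carrier J_add J_mult)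
qed (rule del_J_gens)

lemma theta_J: "theta n ` J n = (J n :: 'k::field zpoly set)"
proof
  show sub: "theta n ` J n \<subseteq> (J n :: 'k zpoly set)"
    unfolding J_def
  proof (rule genideal_invariant[OF ring_F J_gens_carrier linear_endo_theta], fold J_def)
    fix a x :: "'k zpoly"
    assume *: "a \<in> carrier (F n)" "x \<in> J n" "theta n x \<in> J n"
    then have "theta n a \<in> carrier (F n)" by (simp add: linear_endo_closed[OF linear_endo_theta])
    with * show "theta n (a \<otimes>\<^bsub>F n\<^esub> x) \<in> J n" "theta n (x \<otimes>\<^bsub>F n\<^esub> a) \<in> J n"
      by (simp_all add: F_simps theta_mult J_carrier J_mult)
  qed (use theta_J_gens J_gens_subset_J in blast)
  show "(J n :: 'k zpoly set) \<subseteq> theta n ` J n"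
  proof
    fix x :: "'k zpoly" assume "x \<in> J n"
    then show "x \<in> theta n ` J n"
      using sub theta_theta[OF J_carrier, of x n] by (metis imageI subsetD)
  qed
qed

section \<open>Induced maps on the quotient\<close>

lemma Q_carrierE:
  assumes "X \<in> carrier (Q n)"
  obtains x where "x \<in> carrier (F n)" "X = J n +>\<^bsub>F n\<^esub> x"
  using assms by (auto simp: Q_simps A_RCOSETS_def')

lemma Q_carrierI: "x \<in> carrier (F n) \<Longrightarrow> J n +>\<^bsub>F n\<^esub> x \<in> carrier (Q n)"
  by (auto simp: Q_simps A_RCOSETS_def')

lemma Q_add:
  "x \<in> carrier (F n) \<Longrightarrow> y \<in> carrier (F n) \<Longrightarrow>
    (J n +>\<^bsub>F n\<^esub> x) \<oplus>\<^bsub>Q n\<^esub> (J n +>\<^bsub>F n\<^esub> y) = J n +>\<^bsub>F n\<^esub> (x + y)"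
  using abelian_subgroup.a_rcos_sum[OF ideal.axioms(1)[OF ideal_J, THEN abelian_subgroupI3[OF _ ring.is_abelian_group[OF ring_F]]]]
  by (simp add: Q_simps F_simps)

lemma Q_mult:
  "x \<in> carrier (F n) \<Longrightarrow> y \<in> carrier (F n) \<Longrightarrow>
    (J n +>\<^bsub>F n\<^esub> x) \<otimes>\<^bsub>Q n\<^esub> (J n +>\<^bsub>F n\<^esub> y) = J n +>\<^bsub>F n\<^esub> (x * y)"
  using ideal.rcoset_mult_add[OF ideal_J] by (simp add: Q_simps F_simps)

lemma F_smult: "x \<in> carrier (F n) \<Longrightarrow> c \<odot>\<^bsub>F n\<^esub> x \<in> carrier (F n)"
  unfolding F_def free_algebra_simps(6) zero_word_def by (intro carrier_mult carrier_single) auto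

lemma J_coset_eq_iff:
  fixes x y :: "'k::field zpoly"
  assumes "x \<in> carrier (F n)" "y \<in> carrier (F n)"
  shows "J n +>\<^bsub>F n\<^esub> x = J n +>\<^bsub>F n\<^esub> y \<longleftrightarrow> x - y \<in> J n"
proof -
  interpret R: ring "F n :: ('k, 'k zpoly) module" by (rule ring_F)
  have "x \<ominus>\<^bsub>F n\<^esub> y = x - y"
    using assms R.minus_equality[of "- y" y] carrier_uminus[of y "z_index n", folded F_def]
    by (simp add: a_minus_def F_simps)
  then show ?thesis
    using R.quotient_eq_iff_same_a_r_cos[OF ideal_J assms] by simp
qed

text \<open>
  Uniting the cosets of the images of all representatives avoids a choice of representative;
  for a linear map preserving \<open>J n\<close> these cosets coincide.
\<close>

definition coset_map :: "nat \<Rightarrow> ('k::field zpoly \<Rightarrow> 'k zpoly) \<Rightarrow> 'k zpoly set \<Rightarrow> 'k zpoly set"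
  where "coset_map n f X = (\<Union>x\<in>X. J n +>\<^bsub>F n\<^esub> f x)"

lemma coset_map_coset:
  fixes f :: "'k::field zpoly \<Rightarrow> 'k zpoly"
  assumes f: "linear_endo (F n) f" "f ` J n \<subseteq> J n" and x: "x \<in> carrier (F n)"
  shows "coset_map n f (J n +>\<^bsub>F n\<^esub> x) = J n +>\<^bsub>F n\<^esub> f x"
proof -
  interpret ideal "J n :: 'k zpoly set" "F n" by (rule ideal_J)
  have "J n +>\<^bsub>F n\<^esub> f y = J n +>\<^bsub>F n\<^esub> f x" if y: "y \<in> J n +>\<^bsub>F n\<^esub> x" for y
  proof -
    have yc: "y \<in> carrier (F n)" using y x a_r_coset_subset_G[OF a_subset] by blast
    have "J n +>\<^bsub>F n\<^esub> y = J n +>\<^bsub>F n\<^esub> x"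
      using a_repr_independence[OF y x] a_subgroup by simp
    then have "f (y - x) \<in> J n" using f(2) J_coset_eq_iff[OF yc x] by blast
    then show ?thesis
      by (simp add: J_coset_eq_iff linear_endo_closed[OF f(1)] linear_endo_minus[OF f(1)] x yc)
  qed
  moreover have "x \<in> J n +>\<^bsub>F n\<^esub> x" by (rule a_rcos_self[OF x])
  ultimately show ?thesis unfolding coset_map_def by blast
qed

lemma linear_endo_coset_map:
  fixes f :: "'k::field zpoly \<Rightarrow> 'k zpoly"
  assumes f: "linear_endo (F n) f" "f ` J n \<subseteq> J n"
  shows "linear_endo (Q n) (coset_map n f)"
  unfolding linear_endo_def
proof (intro conjI allI ballI Pi_I)
  note [simp] = coset_map_coset[OF f] linear_endo_closed[OF f(1)] linear_endo_add[OF f(1)]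
    F_add F_smult Q_add Q_smult Q_carrierI
  show "coset_map n f X \<in> carrier (Q n)" if "X \<in> carrier (Q n)" for X
    using that by (auto elim!: Q_carrierE)
  show "coset_map n f (X \<oplus>\<^bsub>Q n\<^esub> Y) = coset_map n f X \<oplus>\<^bsub>Q n\<^esub> coset_map n f Y"
    if "X \<in> carrier (Q n)" "Y \<in> carrier (Q n)" for X Y
    using that by (auto elim!: Q_carrierE)
  have "f (c \<odot>\<^bsub>F n\<^esub> x) = c \<odot>\<^bsub>F n\<^esub> f x" if "x \<in> carrier (F n)" for c x
    using f(1) that by (auto simp: linear_endo_def)
  then show "coset_map n f (c \<odot>\<^bsub>Q n\<^esub> X) = c \<odot>\<^bsub>Q n\<^esub> coset_map n f X"
    if "X \<in> carrier (Q n)" for c X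
    using that by (auto elim!: Q_carrierE)
qed

lemma derivation_coset_map:
  assumes d: "derivation (F n) d" "d ` J n \<subseteq> J n"
  shows "derivation (Q n) (coset_map n d)"
proof -
  have lin: "linear_endo (F n) d" using d(1) by (simp add: derivation_def)
  have "d (x * y) = d x * y + x * d y" if "x \<in> carrier (F n)" "y \<in> carrier (F n)" for x y
    using d(1) that by (auto simp: derivation_def F_simps)
  then show ?thesis
    unfolding derivation_def
    by (auto simp: linear_endo_coset_map[OF lin d(2)] coset_map_coset[OF lin d(2)]
        linear_endo_closed[OF lin] F_add F_mult Q_add Q_mult elim!: Q_carrierE)
qed

text \<open>
  Injectivity on the quotient requires that no element outside \<open>J n\<close> be mapped into \<open>J n\<close>.
  For the injective map \<open>t\<close> this follows from \<open>t ` J n = J n\<close>, whereas the inclusion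
  \<open>t ` J n \<subseteq> J n\<close> would only make the induced map well defined.
\<close>

lemma antiautomorphism_coset_map:
  fixes t :: "'k::field zpoly \<Rightarrow> 'k zpoly"
  assumes t: "antiautomorphism (F n) t" "t ` J n = J n"
  shows "antiautomorphism (Q n) (coset_map n t)"
proof -
  have lin: "linear_endo (F n) t" and bij: "bij_betw t (carrier (F n)) (carrier (F n))"
    and one: "t 1 = 1"
    using t(1) by (simp_all add: antiautomorphism_def F_simps)
  have mult: "t (x * y) = t y * t x" if "x \<in> carrier (F n)" "y \<in> carrier (F n)" for x y
    using t(1) that by (auto simp: antiautomorphism_def F_simps)
  note coset = coset_map_coset[OF lin equalityD1[OF t(2)]]
  note closed = linear_endo_closed[OF lin]
  have "inj_on (coset_map n t) (carrier (Q n))"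
  proof (rule inj_onI)
    fix X Y assume "X \<in> carrier (Q n)" "Y \<in> carrier (Q n)" and eq: "coset_map n t X = coset_map n t Y"
    then obtain x y where x: "x \<in> carrier (F n)" "X = J n +>\<^bsub>F n\<^esub> x"
      and y: "y \<in> carrier (F n)" "Y = J n +>\<^bsub>F n\<^esub> y"
      by (elim Q_carrierE)
    have "t (x - y) \<in> J n"
      using eq x y by (simp add: coset J_coset_eq_iff closed linear_endo_minus[OF lin])
    then obtain w where "w \<in> J n" "t w = t (x - y)" using t(2) by (metis imageE)
    then have "x - y \<in> J n"
      using bij_betw_imp_inj_on[OF bij] F_minus[OF x(1) y(1)] J_carrier by (metis inj_onD)
    then show "X = Y" using x y by (simp add: J_coset_eq_iff)
  qed
  moreover have "coset_map n t ` carrier (Q n) = carrier (Q n)"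
  proof (intro equalityI subsetI)
    fix X :: "'k zpoly set" assume "X \<in> carrier (Q n)"
    then obtain x where x: "x \<in> carrier (F n)" "X = J n +>\<^bsub>F n\<^esub> x" by (rule Q_carrierE)
    obtain y where "y \<in> carrier (F n)" "x = t y"
      using bij_betw_imp_surj_on[OF bij] x(1) by blast
    then show "X \<in> coset_map n t ` carrier (Q n)"
      using x(2) by (metis coset Q_carrierI imageI)
  qed (auto simp: coset closed Q_carrierI elim!: Q_carrierE)
  moreover have "coset_map n t \<one>\<^bsub>Q n\<^esub> = \<one>\<^bsub>Q n\<^esub>"
    using carrier_1[of "z_index n", where ?'b = 'k] by (simp add: Q_simps(3) coset one F_def[symmetric])
  ultimately show ?thesis
    unfolding antiautomorphism_def bij_betw_def
    by (auto simp: linear_endo_coset_map[OF lin equalityD1[OF t(2)]] coset closed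
        F_mult Q_mult mult elim!: Q_carrierE)
qed

theorem proposition1p1p1:
  fixes n :: nat
  assumes "n \<ge> 1"
  shows "(del n ` J n \<subseteq> (J n :: 'k::field zpoly set) \<and>
      (\<exists>d :: 'k zpoly set \<Rightarrow> 'k zpoly set. derivation (Q n) d \<and>
        (\<forall>x\<in>carrier (F n). d (J n +>\<^bsub>F n\<^esub> x) = J n +>\<^bsub>F n\<^esub> del n x) \<and>
        (\<forall>A i. A \<subseteq> {1..n} \<and> i \<in> {1..n} - A \<longrightarrow> d (zQ n A i) = \<one>\<^bsub>Q n\<^esub>))) \<and>
    (theta n ` J n = (J n :: 'k zpoly set) \<and>
      (\<exists>t :: 'k zpoly set \<Rightarrow> 'k zpoly set. antiautomorphism (Q n) t \<and>
        (\<forall>x\<in>carrier (F n). t (J n +>\<^bsub>F n\<^esub> x) = J n +>\<^bsub>F n\<^esub> theta n x) \<and>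
        (\<forall>A i. A \<subseteq> {1..n} \<and> i \<in> {1..n} - A \<longrightarrow>
          t (zQ n A i) = zQ n ({1..n} - (A \<union> {i})) i)))"
proof (intro conjI exI allI ballI impI)
  note del = coset_map_coset[OF linear_endo_del del_J]
  note theta = coset_map_coset[OF linear_endo_theta equalityD1[OF theta_J]]
  show "del n ` J n \<subseteq> (J n :: 'k zpoly set)"
    by (rule del_J)
  show "derivation (Q n) (coset_map n (del n) :: 'k zpoly set \<Rightarrow> 'k zpoly set)"
    by (rule derivation_coset_map[OF derivation_del del_J])
  show "coset_map n (del n) (J n +>\<^bsub>F n\<^esub> x) = J n +>\<^bsub>F n\<^esub> del n x"
    if "x \<in> carrier (F n)" for x :: "'k zpoly"
    by (rule del[OF that])
  show "coset_map n (del n) (zQ n A i :: 'k zpoly set) = \<one>\<^bsub>Q n\<^esub>"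
    if "A \<subseteq> {1..n} \<and> i \<in> {1..n} - A" for A i
  proof -
    have "(A, i) \<in> z_index n" using that by (simp add: z_index_def)
    then show ?thesis by (simp add: zQ_def del z_carrier del_z Q_simps(3))
  qed
  show "theta n ` J n = (J n :: 'k zpoly set)"
    by (rule theta_J)
  show "antiautomorphism (Q n) (coset_map n (theta n) :: 'k zpoly set \<Rightarrow> 'k zpoly set)"
    by (rule antiautomorphism_coset_map[OF antiautomorphism_theta theta_J])
  show "coset_map n (theta n) (J n +>\<^bsub>F n\<^esub> x) = J n +>\<^bsub>F n\<^esub> theta n x"
    if "x \<in> carrier (F n)" for x :: "'k zpoly"
    by (rule theta[OF that])
  show "coset_map n (theta n) (zQ n A i :: 'k zpoly set) = zQ n ({1..n} - (A \<union> {i})) i"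
    if "A \<subseteq> {1..n} \<and> i \<in> {1..n} - A" for A i
  proof -
    have "(A, i) \<in> z_index n" using that by (simp add: z_index_def)
    then show ?thesis by (simp add: zQ_def theta z_carrier theta_z)
  qed
qed

end
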